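(* Given $r>0$, there exists $\delta>0$, depending only on $n$, $s$, $\lambda$, $\Lambda$ and $r$, such that the following holds. If $a>0$ and $w$ satisfies $Lw\ge a$ in $B_r\cap\{w\le0\}$ and $w\ge-\delta a$ in all of $\mathbb{R}^n$, then $w>0$ in $\overline{B_{r/2}}$.
   Context: Let $n\ge2$, $s\in(0,1)$. $Lu(x)=\int_{\mathbb{R}^n}(u(x)-u(x+y))\frac{\mu(y/|y|)}{|y|^{n+s}}dy$ with $\mu:S^{n-1}\to\mathbb{R}$ measurable, $\mu(z)=\mu(-z)$ and $0<\lambda\le\mu\le\Lambda<\infty$. *)

theory Defs
  imports "HOL-Analysis.Analysis"
begin

definition stable_integrand ::
  "('a::euclidean_space \<Rightarrow> real) \<Rightarrow> real \<Rightarrow> ('a \<Rightarrow> real) \<Rightarrow> 'a \<Rightarrow> 'a \<Rightarrow> real" where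
  "stable_integrand mu s u x y =
     (u x - u (x + y)) * mu (y /\<^sub>R norm y) / norm y powr (real DIM('a) + s)"

definition stable_op_defined ::
  "('a::euclidean_space \<Rightarrow> real) \<Rightarrow> real \<Rightarrow> ('a \<Rightarrow> real) \<Rightarrow> 'a \<Rightarrow> bool" where
  "stable_op_defined mu s u x = integrable lborel (stable_integrand mu s u x)"

definition stable_op ::
  "('a::euclidean_space \<Rightarrow> real) \<Rightarrow> real \<Rightarrow> ('a \<Rightarrow> real) \<Rightarrow> 'a \<Rightarrow> real" where
  "stable_op mu s u x = (\<integral>y. stable_integrand mu s u x y \<partial>lborel)"

end

theory Submission
  imports Defs
begin

text \<open>If w(x0) \<le> 0 for some |x0| \<le> r/2, subtract from w the bump 2\<delta>a\<eta>, where \<eta> is a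
  Lipschitz cutoff equal to 1 on the ball of radius r/2 and vanishing outside radius 3r/4. Because
  w \<ge> -\<delta>a everywhere, the difference attains its global minimum at a point xm with |xm| \<le> 3r/4
  and w(xm) \<le> 0, where the bump touches w from below: w(xm) - w(xm + y) \<le> c \<delta>a min(1, |y|).
  Since min(1, |y|) / |y|^(n+s) is integrable for 0 < s < 1 (a dyadic decomposition reduces this to
  two geometric series), Lw(xm) \<le> c' \<delta>a, which is smaller than a once \<delta> is small.
  Only the bounds 0 \<le> \<mu> \<le> \<Lambda> enter.\<close>

lemma exists_dyadic_bracket:
  fixes t :: real
  assumes "1 \<le> t"
  obtains k :: nat where "2 powr real k \<le> t" "t < 2 powr (real k + 1)"
proof
  define k where "k = nat \<lfloor>log 2 t\<rfloor>"
  have "0 \<le> log 2 t" using assms by simp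
  then have "real k \<le> log 2 t" "log 2 t < real k + 1" unfolding k_def by linarith+
  then show "2 powr real k \<le> t" "t < 2 powr (real k + 1)"
    using assms by (simp_all add: le_log_iff log_less_iff)
qed

definition ball_series :: "(nat \<Rightarrow> real) \<Rightarrow> (nat \<Rightarrow> real) \<Rightarrow> 'a::real_normed_vector \<Rightarrow> ennreal" where
  "ball_series c R y = (\<Sum>k. ennreal (c k) * indicator (cball 0 (R k)) y)"

lemma ball_series_ge_term: "ennreal (c k) * indicator (cball 0 (R k)) y \<le> ball_series c R y"
  unfolding ball_series_def using ennreal_suminf_lessD leI by blast

lemma borel_measurable_ball_series:
  "(ball_series c R :: 'a::euclidean_space \<Rightarrow> ennreal) \<in> borel_measurable lborel"
  unfolding ball_series_def by measurable (auto simp: pred_def)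

lemma nn_integral_ball_series_finite:
  fixes c R :: "nat \<Rightarrow> real" and A q :: real
  assumes "\<And>k. 0 \<le> c k" and "\<And>k. 0 \<le> R k"
    and "\<And>k. c k * R k ^ DIM('a) = A * q ^ k"
    and "0 \<le> A" and "0 \<le> q" and "q < 1"
  shows "(\<integral>\<^sup>+y. ball_series c R (y::'a::euclidean_space) \<partial>lborel) < \<infinity>"
proof -
  define V where "V = unit_ball_vol (real DIM('a))"
  have "0 \<le> V" unfolding V_def by simp
  have "(\<integral>\<^sup>+y. ball_series c R (y::'a) \<partial>lborel)
      = (\<Sum>k. \<integral>\<^sup>+y. ennreal (c k) * indicator (cball (0::'a) (R k)) y \<partial>lborel)"
    unfolding ball_series_def by (rule nn_integral_suminf) (measurable, auto simp: pred_def)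
  also have "\<dots> = (\<Sum>k. ennreal (V * A * q ^ k))"
  proof (rule suminf_cong)
    fix k
    have "(\<integral>\<^sup>+y. ennreal (c k) * indicator (cball (0::'a) (R k)) y \<partial>lborel)
        = ennreal (c k) * ennreal (V * R k ^ DIM('a))"
      using assms(2)[of k] by (simp add: nn_integral_cmult_indicator emeasure_cball V_def)
    also have "\<dots> = ennreal (V * (c k * R k ^ DIM('a)))"
      using assms(1,2)[of k] \<open>0 \<le> V\<close> by (simp add: ennreal_mult'[symmetric] mult_ac)
    finally show "(\<integral>\<^sup>+y. ennreal (c k) * indicator (cball (0::'a) (R k)) y \<partial>lborel)
        = ennreal (V * A * q ^ k)"
      by (simp add: assms(3) mult.assoc)
  qed
  also have "\<dots> = ennreal (\<Sum>k. V * A * q ^ k)"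
    using assms \<open>0 \<le> V\<close> by (intro suminf_ennreal2 summable_mult summable_geometric) auto
  finally show ?thesis by simp
qed

lemma min_norm_div_powr_le_ball_series:
  fixes y :: "'a::real_normed_vector" and p :: real
  assumes "1 \<le> p"
  shows "ennreal (min 1 (norm y) / norm y powr p)
    \<le> ball_series (\<lambda>k. 2 powr (- p * real k)) (\<lambda>k. 2 powr (real k + 1)) y
      + ball_series (\<lambda>k. 2 powr ((p - 1) * (real k + 1))) (\<lambda>k. 2 powr (- real k)) y"
proof -
  consider "y = 0" | "1 \<le> norm y" | "0 < norm y" "norm y < 1" by force
  then show ?thesis
  proof cases
    case 1
    then show ?thesis by (simp add: ball_series_def)
  next
    case 2
    then obtain k :: nat where k: "2 powr real k \<le> norm y" "norm y < 2 powr (real k + 1)"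
      by (rule exists_dyadic_bracket)
    have "min 1 (norm y) / norm y powr p = (norm y) powr (- p)"
      using 2 by (simp add: powr_minus_divide)
    also have "\<dots> \<le> (2 powr real k) powr (- p)"
      using k assms by (intro powr_mono2') auto
    also have "\<dots> = 2 powr (- p * real k)"
      by (simp add: powr_powr mult.commute)
    finally have "ennreal (min 1 (norm y) / norm y powr p)
        \<le> ennreal (2 powr (- p * real k)) * indicator (cball 0 (2 powr (real k + 1))) y"
      using k by (simp add: ennreal_leI add.commute)
    also have "\<dots> \<le> ball_series (\<lambda>k. 2 powr (- p * real k)) (\<lambda>k. 2 powr (real k + 1)) y"
      by (rule ball_series_ge_term)
    finally show ?thesis by (simp add: add_increasing2)
  next
    case 3
    then obtain k :: nat where k: "2 powr real k \<le> 1 / norm y" "1 / norm y < 2 powr (real k + 1)"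
      using exists_dyadic_bracket[of "1 / norm y"] by auto
    have "1 < norm y * 2 powr (real k + 1)" "norm y * 2 powr real k \<le> 1"
      using k 3 by (simp_all add: field_simps)
    then have y_lo: "2 powr (- (real k + 1)) < norm y" and y_hi: "norm y \<le> 2 powr (- real k)"
      unfolding powr_minus_divide by (simp_all add: divide_less_eq le_divide_eq mult.commute)
    have "min 1 (norm y) / norm y powr p = (norm y) powr (1 - p)"
      using 3 by (simp add: powr_diff)
    also have "\<dots> \<le> (2 powr (- (real k + 1))) powr (1 - p)"
      using y_lo assms by (intro powr_mono2') auto
    also have "\<dots> = 2 powr ((p - 1) * (real k + 1))"
      by (simp add: powr_powr algebra_simps)
    finally have "ennreal (min 1 (norm y) / norm y powr p)
        \<le> ennreal (2 powr ((p - 1) * (real k + 1))) * indicator (cball 0 (2 powr (- real k))) y"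
      using y_hi by (simp add: ennreal_leI)
    also have "\<dots> \<le> ball_series (\<lambda>k. 2 powr ((p - 1) * (real k + 1))) (\<lambda>k. 2 powr (- real k)) y"
      by (rule ball_series_ge_term)
    finally show ?thesis by (simp add: add_increasing)
  qed
qed

lemma powr_affine_mult_power:
  fixes x :: real
  assumes "0 < x"
  shows "x powr (a * real k + b) * (x powr (c * real k + d)) ^ n
       = x powr (b + real n * d) * (x powr (a + real n * c)) ^ k"
  using assms by (simp add: powr_power flip: powr_add) (simp add: algebra_simps)

lemma integrable_min_norm_div_norm_powr:
  fixes s :: real
  assumes "0 < s" and "s < 1"
  shows "integrable lborel (\<lambda>y::'a::euclidean_space. min 1 (norm y) / norm y powr (real DIM('a) + s))"
proof -
  define n where "n = DIM('a)"
  define p where "p = real n + s"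
  have "1 \<le> real n" unfolding n_def using DIM_positive[where 'a='a] by linarith
  then have "1 \<le> p" unfolding p_def using assms(1) by linarith
  define outer :: "'a \<Rightarrow> ennreal" where "outer = ball_series (\<lambda>k. 2 powr (- p * real k)) (\<lambda>k. 2 powr (real k + 1))"
  define inner :: "'a \<Rightarrow> ennreal" where "inner = ball_series (\<lambda>k. 2 powr ((p - 1) * (real k + 1))) (\<lambda>k. 2 powr (- real k))"
  have outer_finite: "(\<integral>\<^sup>+y. outer y \<partial>lborel) < \<infinity>"
    unfolding outer_def
  proof (rule nn_integral_ball_series_finite)
    show "2 powr (- p * real k) * (2 powr (real k + 1)) ^ DIM('a) = 2 powr n * (2 powr (- s)) ^ k" for k :: nat
      using powr_affine_mult_power[of 2 "- p" k 0 1 1 n] unfolding p_def n_def by (simp add: add.commute)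
    show "2 powr (- s) < 1"
      using assms by (intro powr_less_one) auto
  qed auto
  have inner_finite: "(\<integral>\<^sup>+y. inner y \<partial>lborel) < \<infinity>"
    unfolding inner_def
  proof (rule nn_integral_ball_series_finite)
    show "2 powr ((p - 1) * (real k + 1)) * (2 powr (- real k)) ^ DIM('a) = 2 powr (p - 1) * (2 powr (s - 1)) ^ k"
      for k :: nat
      using powr_affine_mult_power[of 2 "p - 1" k "p - 1" "- 1" 0 n] unfolding p_def n_def
      by (simp add: algebra_simps)
    show "2 powr (s - 1) < 1"
      using assms by (intro powr_less_one) auto
  qed auto
  have "(\<integral>\<^sup>+y. ennreal (norm (min 1 (norm (y::'a)) / norm y powr p)) \<partial>lborel)
      \<le> (\<integral>\<^sup>+y. outer y + inner y \<partial>lborel)"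
    using min_norm_div_powr_le_ball_series[OF \<open>1 \<le> p\<close>]
    unfolding outer_def inner_def by (intro nn_integral_mono) simp
  also have "\<dots> = (\<integral>\<^sup>+y. outer y \<partial>lborel) + (\<integral>\<^sup>+y. inner y \<partial>lborel)"
    unfolding outer_def inner_def by (intro nn_integral_add borel_measurable_ball_series)
  also have "\<dots> < \<infinity>"
    using outer_finite inner_finite by (simp add: ennreal_add_less_top)
  finally have "(\<integral>\<^sup>+y. ennreal (norm (min 1 (norm (y::'a)) / norm y powr p)) \<partial>lborel) < \<infinity>" .
  moreover have "(\<lambda>y::'a. min 1 (norm y) / norm y powr p) \<in> borel_measurable lborel"
    by measurable
  ultimately show ?thesis
    unfolding p_def n_def by (intro integrableI_bounded)
qed

lemma continuous_attains_global_inf: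
  fixes f :: "'a::metric_space \<Rightarrow> real"
  assumes "compact K" and "continuous_on K f" and "x0 \<in> K"
    and "\<And>z. z \<notin> K \<Longrightarrow> f x0 \<le> f z"
  obtains xm where "xm \<in> K" and "\<And>z. f xm \<le> f z"
proof -
  obtain xm where "xm \<in> K" and "\<And>z. z \<in> K \<Longrightarrow> f xm \<le> f z"
    using continuous_attains_inf[OF assms(1) _ assms(2)] assms(3) by blast
  with assms(3,4) show thesis
    by (meson order_trans that)
qed

definition plateau_cutoff :: "real \<Rightarrow> 'a::real_normed_vector \<Rightarrow> real" where
  "plateau_cutoff r x = min 1 (max 0 (3 - 4 / r * norm x))"

lemma plateau_cutoff_bounds: "0 \<le> plateau_cutoff r x" "plateau_cutoff r x \<le> 1"
  unfolding plateau_cutoff_def by simp_all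

lemma plateau_cutoff_eq_1: "0 < r \<Longrightarrow> norm x \<le> r / 2 \<Longrightarrow> plateau_cutoff r x = 1"
  unfolding plateau_cutoff_def by (simp add: field_simps)

lemma plateau_cutoff_eq_0: "0 < r \<Longrightarrow> 3 * r / 4 \<le> norm x \<Longrightarrow> plateau_cutoff r x = 0"
  unfolding plateau_cutoff_def by (simp add: field_simps)

lemma continuous_on_plateau_cutoff: "continuous_on A (plateau_cutoff r)"
  unfolding plateau_cutoff_def by (intro continuous_intros)

lemma plateau_cutoff_lipschitz:
  assumes "0 < r"
  shows "\<bar>plateau_cutoff r x - plateau_cutoff r z\<bar> \<le> 4 / r * dist x z"
proof -
  have clamp: "\<bar>min 1 (max 0 u) - min 1 (max 0 v)\<bar> \<le> \<bar>u - v\<bar>" for u v :: real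
    by (simp add: abs_if min_def max_def)
  have "\<bar>plateau_cutoff r x - plateau_cutoff r z\<bar> \<le> \<bar>(3 - 4 / r * norm x) - (3 - 4 / r * norm z)\<bar>"
    unfolding plateau_cutoff_def by (rule clamp)
  also have "\<dots> = \<bar>4 / r * (norm z - norm x)\<bar>"
    by (rule arg_cong[where f = abs]) (simp add: right_diff_distrib)
  also have "\<dots> = 4 / r * \<bar>norm z - norm x\<bar>"
    using assms by (subst abs_mult) simp
  also have "\<dots> \<le> 4 / r * dist x z"
    using assms norm_triangle_ineq3[of z x] by (intro mult_left_mono) (auto simp: dist_norm norm_minus_commute)
  finally show ?thesis .
qed

lemma plateau_cutoff_increment_le:
  assumes "0 < r"
  shows "plateau_cutoff r x - plateau_cutoff r (x + y) \<le> max 1 (4 / r) * min 1 (norm y)"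
proof (cases "norm y \<le> 1")
  case True
  have "plateau_cutoff r x - plateau_cutoff r (x + y) \<le> 4 / r * norm y"
    using plateau_cutoff_lipschitz[OF assms, of x "x + y"] by (simp add: dist_norm)
  also have "\<dots> \<le> max 1 (4 / r) * norm y"
    by (intro mult_right_mono) auto
  finally show ?thesis using True by simp
next
  case False
  then show ?thesis
    using plateau_cutoff_bounds[of r x] plateau_cutoff_bounds[of r "x + y"] by simp
qed

lemma touching_point_below:
  fixes w :: "'a::euclidean_space \<Rightarrow> real"
  assumes "continuous_on UNIV w" and "0 < r" and "0 \<le> \<epsilon>"
    and "\<And>x. - \<epsilon> \<le> w x" and "norm x0 \<le> r / 2" and "w x0 \<le> 0"
  obtains xm where "norm xm < r" and "w xm \<le> 0"
    and "\<And>y. w xm - w (xm + y) \<le> 2 * \<epsilon> * max 1 (4 / r) * min 1 (norm y)"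
proof -
  define v where "v x = w x - 2 * \<epsilon> * plateau_cutoff r x" for x
  define K where "K = cball (0::'a) (3 * r / 4)"
  have v_x0: "v x0 = w x0 - 2 * \<epsilon>"
    unfolding v_def using plateau_cutoff_eq_1[OF assms(2,5)] by simp
  have "compact K" unfolding K_def by simp
  have "continuous_on UNIV v"
    unfolding v_def by (intro continuous_intros assms(1) continuous_on_plateau_cutoff)
  then have "continuous_on K v"
    by (rule continuous_on_subset) simp
  have "x0 \<in> K" unfolding K_def using assms(2,5) by simp
  have "v x0 \<le> v z" if "z \<notin> K" for z
  proof -
    have "v z = w z"
      using that plateau_cutoff_eq_0[OF assms(2), of z] unfolding v_def K_def by simp
    then show ?thesis using v_x0 assms(3,6) assms(4)[of z] by linarith
  qed
  then obtain xm where "xm \<in> K" and xm_min: "\<And>z. v xm \<le> v z"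
    using continuous_attains_global_inf[OF \<open>compact K\<close> \<open>continuous_on K v\<close> \<open>x0 \<in> K\<close>] by blast
  show thesis
  proof
    show "norm xm < r" using \<open>xm \<in> K\<close> assms(2) unfolding K_def by simp
    have "2 * \<epsilon> * plateau_cutoff r xm \<le> 2 * \<epsilon>"
      using assms(3) plateau_cutoff_bounds(2)[of r xm] by (simp add: mult_left_le)
    then show "w xm \<le> 0"
      using xm_min[of x0] v_x0 assms(6) unfolding v_def by linarith
    show "w xm - w (xm + y) \<le> 2 * \<epsilon> * max 1 (4 / r) * min 1 (norm y)" for y
    proof -
      have "w xm - w (xm + y) \<le> 2 * \<epsilon> * (plateau_cutoff r xm - plateau_cutoff r (xm + y))"
        using xm_min[of "xm + y"] unfolding v_def right_diff_distrib by linarith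
      also have "\<dots> \<le> 2 * \<epsilon> * (max 1 (4 / r) * min 1 (norm y))"
        using assms(3) plateau_cutoff_increment_le[OF assms(2)] by (intro mult_left_mono) auto
      finally show ?thesis by (simp add: mult.assoc)
    qed
  qed
qed

lemma stable_op_le_of_increment_bound:
  fixes u :: "'a::euclidean_space \<Rightarrow> real"
  assumes "0 < s" and "s < 1" and "stable_op_defined mu s u x"
    and "\<And>z. z \<in> sphere 0 1 \<Longrightarrow> 0 \<le> mu z \<and> mu z \<le> Lam"
    and "0 \<le> K" and "\<And>y. u x - u (x + y) \<le> K * min 1 (norm y)"
  shows "stable_op mu s u x
    \<le> K * Lam * (\<integral>y. min 1 (norm (y::'a)) / norm y powr (real DIM('a) + s) \<partial>lborel)"
proof -
  let ?G = "\<lambda>y::'a. min 1 (norm y) / norm y powr (real DIM('a) + s)"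
  have "stable_integrand mu s u x y \<le> K * Lam * ?G y" for y
  proof (cases "y = 0")
    case False
    then have mu: "0 \<le> mu (y /\<^sub>R norm y)" "mu (y /\<^sub>R norm y) \<le> Lam"
      using assms(4)[of "y /\<^sub>R norm y"] by auto
    have "(u x - u (x + y)) * mu (y /\<^sub>R norm y) \<le> K * min 1 (norm y) * mu (y /\<^sub>R norm y)"
      using assms(6) mu(1) by (rule mult_right_mono)
    also have "\<dots> \<le> K * min 1 (norm y) * Lam"
      using assms(5) mu(2) by (intro mult_left_mono) auto
    finally show ?thesis
      unfolding stable_integrand_def by (simp add: divide_right_mono mult_ac)
  qed (simp add: stable_integrand_def)
  then have "stable_op mu s u x \<le> (\<integral>y. K * Lam * ?G y \<partial>lborel)"
    using assms(1-3) unfolding stable_op_def stable_op_defined_def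
    by (intro integral_mono integrable_mult_right integrable_min_norm_div_norm_powr)
  also have "\<dots> = K * Lam * (\<integral>y. ?G y \<partial>lborel)"
    by (rule integral_mult_right_zero)
  finally show ?thesis .
qed

lemma stable_supersolution_pos_on_half_ball:
  fixes w :: "'a::euclidean_space \<Rightarrow> real"
  assumes "0 < s" and "s < 1" and "0 < r" and "0 < a" and "0 \<le> \<delta>"
    and "\<And>z. z \<in> sphere 0 1 \<Longrightarrow> 0 \<le> mu z \<and> mu z \<le> Lam"
    and "continuous_on UNIV w"
    and Lw: "\<And>x. x \<in> ball 0 r \<Longrightarrow> w x \<le> 0 \<Longrightarrow> stable_op_defined mu s w x \<and> a \<le> stable_op mu s w x"
    and "\<And>x. - (\<delta> * a) \<le> w x"
    and \<delta>_small: "\<delta> * (2 * max 1 (4 / r) * Lam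
        * (\<integral>y. min 1 (norm (y::'a)) / norm y powr (real DIM('a) + s) \<partial>lborel)) < 1"
    and "norm x \<le> r / 2"
  shows "0 < w x"
proof (rule ccontr)
  assume "\<not> 0 < w x"
  then have "w x \<le> 0" by simp
  have "0 \<le> \<delta> * a" using assms(4,5) by simp
  then obtain xm where "norm xm < r" and "w xm \<le> 0"
    and increment: "\<And>y. w xm - w (xm + y) \<le> 2 * (\<delta> * a) * max 1 (4 / r) * min 1 (norm y)"
    using touching_point_below[OF assms(7,3) _ assms(9,11) \<open>w x \<le> 0\<close>] by blast
  then have "stable_op_defined mu s w xm" and "a \<le> stable_op mu s w xm"
    using Lw by auto
  note \<open>a \<le> stable_op mu s w xm\<close>
  also have "stable_op mu s w xm \<le> 2 * (\<delta> * a) * max 1 (4 / r) * Lam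
      * (\<integral>y. min 1 (norm (y::'a)) / norm y powr (real DIM('a) + s) \<partial>lborel)"
    using \<open>0 \<le> \<delta> * a\<close>
    by (intro stable_op_le_of_increment_bound[OF assms(1,2) \<open>stable_op_defined mu s w xm\<close>
        assms(6) _ increment]) (auto intro: mult_nonneg_nonneg)
  also have "\<dots> < a"
    using mult_strict_left_mono[OF \<delta>_small assms(4)] by (simp add: mult_ac)
  finally show False by simp
qed

theorem lemma5p9:
  fixes s lam Lam r :: real
  assumes "DIM('a::euclidean_space) \<ge> 2"
    and "0 < s" and "s < 1"
    and "0 < lam" and "lam \<le> Lam"
    and "0 < r"
  shows "\<exists>\<delta>>0. \<forall>(mu::'a \<Rightarrow> real) (a::real) (w::'a \<Rightarrow> real).
    mu \<in> borel_measurable (restrict_space borel (sphere 0 1))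
    \<and> (\<forall>z\<in>sphere 0 1. mu (- z) = mu z \<and> lam \<le> mu z \<and> mu z \<le> Lam)
    \<and> 0 < a
    \<and> continuous_on UNIV w
    \<and> (\<forall>x\<in>ball 0 r. w x \<le> 0 \<longrightarrow>
          stable_op_defined mu s w x \<and> a \<le> stable_op mu s w x)
    \<and> (\<forall>x. - \<delta> * a \<le> w x)
    \<longrightarrow> (\<forall>x\<in>cball 0 (r / 2). 0 < w x)"
proof -
  define B where "B = 2 * max 1 (4 / r) * Lam
    * (\<integral>y. min 1 (norm (y::'a)) / norm y powr (real DIM('a) + s) \<partial>lborel)"
  have "0 \<le> B"
    unfolding B_def using assms(4,5) by (intro mult_nonneg_nonneg integral_nonneg_AE) auto
  define \<delta> where "\<delta> = 1 / (B + 1)"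
  have "0 < \<delta>" and "\<delta> * B < 1"
    unfolding \<delta>_def using \<open>0 \<le> B\<close> by auto
  show ?thesis
  proof (intro exI[of _ \<delta>] conjI \<open>0 < \<delta>\<close> allI impI ballI; elim conjE)
    fix mu :: "'a \<Rightarrow> real" and a :: real and w :: "'a \<Rightarrow> real" and x :: 'a
    assume mu_bounds: "\<forall>z\<in>sphere 0 1. mu (- z) = mu z \<and> lam \<le> mu z \<and> mu z \<le> Lam"
      and "0 < a" and "continuous_on UNIV w"
      and "\<forall>x\<in>ball 0 r. w x \<le> 0 \<longrightarrow> stable_op_defined mu s w x \<and> a \<le> stable_op mu s w x"
      and "\<forall>x. - \<delta> * a \<le> w x" and "x \<in> cball 0 (r / 2)"
    have "0 \<le> mu z \<and> mu z \<le> Lam" if "z \<in> sphere 0 1" for z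
      using mu_bounds[rule_format, OF that] assms(4) by auto
    then show "0 < w x"
      using \<open>0 < a\<close> \<open>continuous_on UNIV w\<close> \<open>\<forall>x. - \<delta> * a \<le> w x\<close> \<open>0 < \<delta>\<close>
        \<open>\<forall>x\<in>ball 0 r. _\<close> \<open>\<delta> * B < 1\<close> \<open>x \<in> cball 0 (r / 2)\<close> assms(2,3,6)
      unfolding B_def by (intro stable_supersolution_pos_on_half_ball[of s r a \<delta> mu Lam w]) auto
  qed
qed

end
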